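(* If, in a metric space induced by a connected graph on $n$ vertices, no line consists of all $n$ vertices, then there are at least $2^{-8/7}n^{2/7}$ distinct lines.
   Context: Every finite connected undirected graph induces a metric space $(X,d)$, where $X$ is the vertex set of the graph and the distance $d(u,v)$ between vertices $u$ and $v$ is the smallest number of edges in a path from $u$ to $v$. For points $a,b,c$ of a metric space $(X,d)$, write $[abc]$ if $a,b,c$ are three distinct points and $d(a,b)+d(b,c)=d(a,c)$. For any two distinct points $u,v\in X$, the line $\overline{uv}$ is the set $\{p:[puv]\}\cup\{u\}\cup\{p:[upv]\}\cup\{v\}\cup\{p:[uvp]\}$. The lines of $(X,d)$ are the sets $\overline{uv}$ with $u,v$ ranging over pairs of distinct points; distinct lines are counted as distinct subsets of $X$.
   Formalization: The graph is assumed to have at least two vertices: with a single vertex there are no lines, so no line consists of all vertices, yet the claimed lower bound is positive and fails. *)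

theory Defs
  imports
    "HOL-Analysis.Abstract_Metric_Spaces"
    "Graph_Theory.Digraph_Component"
    "Graph_Theory.Arc_Walk"
begin

definition between :: "'a set \<Rightarrow> ('a \<Rightarrow> 'a \<Rightarrow> real) \<Rightarrow> 'a \<Rightarrow> 'a \<Rightarrow> 'a \<Rightarrow> bool" where
  "between X d a b c \<longleftrightarrow>
     a \<in> X \<and> b \<in> X \<and> c \<in> X \<and> a \<noteq> b \<and> b \<noteq> c \<and> a \<noteq> c \<and> d a b + d b c = d a c"

definition metric_line :: "'a set \<Rightarrow> ('a \<Rightarrow> 'a \<Rightarrow> real) \<Rightarrow> 'a \<Rightarrow> 'a \<Rightarrow> 'a set" where
  "metric_line X d u v =
     {p. between X d p u v} \<union> {u} \<union> {p. between X d u p v} \<union> {v} \<union> {p. between X d u v p}"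

definition metric_lines :: "'a set \<Rightarrow> ('a \<Rightarrow> 'a \<Rightarrow> real) \<Rightarrow> 'a set set" where
  "metric_lines X d = {metric_line X d u v |u v. u \<in> X \<and> v \<in> X \<and> u \<noteq> v}"

text \<open>
  An undirected graph is a symmetric digraph without loops and parallel arcs, so that each
  edge is a pair of opposite arcs; the number of edges of a path is the length of its list of
  arcs. The distance is meaningful only for vertices joined by a path.
\<close>

definition graph_dist :: "('a, 'b) pre_digraph \<Rightarrow> 'a \<Rightarrow> 'a \<Rightarrow> real" where
  "graph_dist G u v = real (LEAST k. \<exists>p. pre_digraph.apath G u p v \<and> length p = k)"

text \<open>A connected graph does induce a metric space on its vertices.\<close>

context graph
begin

lemma graph_dist_le_awalk:
  assumes "awalk u p v"
  shows "graph_dist G u v \<le> real (length p)"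
proof -
  have "\<exists>q. apath u q v \<and> length q \<le> length p"
    using assms
  proof (induct rule: awalk_to_apath_induct)
    case (path p)
    then show ?case by (auto simp: apath_def)
  next
    case (decomp p q r s)
    then have "p = q @ r @ s"
      using awalk_cyc_decomp_has_prop[of u p v] by auto
    with decomp show ?case by fastforce
  qed
  then obtain q where q: "apath u q v" "length q \<le> length p" by blast
  have "(LEAST k. \<exists>p. apath u p v \<and> length p = k) \<le> length q"
    by (rule Least_le) (use q in blast)
  with q show ?thesis by (simp add: graph_dist_def)
qed

lemma graph_dist_attained:
  assumes "Digraph_Component.connected G" "u \<in> verts G" "v \<in> verts G"
  obtains p where "apath u p v" "graph_dist G u v = real (length p)"
proof -
  have "u \<rightarrow>\<^sup>* v"
    using symmetric_connected_imp_strongly_connected[OF sym_arcs assms(1)] assms(2,3)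
    by (auto simp: strongly_connected_def)
  then have "\<exists>k p. apath u p v \<and> length p = k" by (simp add: reachable_apath)
  from LeastI_ex[OF this] show ?thesis
    using that by (auto simp: graph_dist_def)
qed

lemma awalk_reverse:
  assumes "awalk u p v"
  shows "\<exists>q. awalk v q u \<and> length q = length p"
  using assms
proof (induct p arbitrary: u)
  case Nil
  then show ?case by (auto simp: awalk_Nil_iff)
next
  case (Cons e p)
  then have e: "e \<in> arcs G" "tail G e = u" and "awalk (head G e) p v"
    by (auto simp: awalk_Cons_iff)
  with Cons.hyps obtain q where q: "awalk v q (head G e)" "length q = length p" by blast
  obtain f where f: "f \<in> arcs G" "tail G f = head G e" "head G f = u"
    using sym_arcs e by (fastforce simp: symmetric_conv)
  then have "awalk (head G e) [f] u" using arc_implies_awalk by metis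
  with q have "awalk v (q @ [f]) u" by auto
  with q show ?case by (intro exI[of _ "q @ [f]"]) simp
qed

lemma graph_dist_sym_le:
  assumes "Digraph_Component.connected G" "u \<in> verts G" "v \<in> verts G"
  shows "graph_dist G v u \<le> graph_dist G u v"
  using graph_dist_attained[OF assms] awalk_reverse graph_dist_le_awalk
  by (metis awalkI_apath)

lemma Metric_space_graph_dist:
  assumes con: "Digraph_Component.connected G"
  shows "Metric_space (verts G) (graph_dist G)"
proof
  show "0 \<le> graph_dist G x y" for x y by (simp add: graph_dist_def)
next
  have nonneg: "0 \<le> graph_dist G x y" for x y by (simp add: graph_dist_def)
  have self: "graph_dist G x x = 0" if "x \<in> verts G" for x
    using graph_dist_le_awalk[of x "[]" x] that nonneg[of x x] by (simp add: awalk_Nil_iff)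
  have commute: "graph_dist G x y = graph_dist G y x" if "x \<in> verts G" "y \<in> verts G" for x y
    using that graph_dist_sym_le[OF con] by (meson antisym)
  show "graph_dist G x y = graph_dist G y x" for x y
  proof (cases "x \<in> verts G \<and> y \<in> verts G")
    case True
    then show ?thesis using commute by blast
  next
    case False
    then have "\<not> apath x p y" "\<not> apath y p x" for p
      using awalk_hd_in_verts awalk_last_in_verts awalkI_apath by blast+
    then show ?thesis by (simp add: graph_dist_def)
  qed
  fix x y z
  assume x: "x \<in> verts G" and y: "y \<in> verts G"
  show "graph_dist G x y = 0 \<longleftrightarrow> x = y"
  proof
    assume "graph_dist G x y = 0"
    with graph_dist_attained[OF con x y] obtain p where "apath x p y" "p = []" by auto
    then show "x = y" by (simp add: apath_Nil_iff)
  qed (use self x in simp)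
  assume z: "z \<in> verts G"
  obtain p q where p: "apath x p y" "graph_dist G x y = real (length p)"
    and q: "apath y q z" "graph_dist G y z = real (length q)"
    using graph_dist_attained[OF con] x y z by metis
  then have "awalk x (p @ q) z" by (blast intro: awalk_appendI awalkI_apath)
  from graph_dist_le_awalk[OF this] p q
  show "graph_dist G x z \<le> graph_dist G x y + graph_dist G y z" by simp
qed

end

end

theory Submission
  imports Defs
begin

text \<open>
  Let \<open>m\<close> be the number of lines, none of them universal.

  A geodesic \<open>w 0, \<dots>, w k\<close> has \<open>k \<le> 2 m\<^sup>2\<close>: if its steps \<open>w i, w (i + 1)\<close>, \<open>i \<in> K\<close>, generate the
  same line, choose \<open>x\<close> outside it. The distance to \<open>x\<close> changes by less than the length of each
  of these steps, so for \<open>i, j \<in> K\<close> the lines through \<open>x, w i\<close> and \<open>x, w j\<close> can agree only if \<open>x\<close>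
  lies between \<open>w i\<close> and \<open>w j\<close>, which cannot happen for three indices at once. Hence
  \<open>card K \<le> 2 m\<close>. So there are at most \<open>2 m\<^sup>2\<close> nonzero distances.

  Now fix a point \<open>p\<close> and classify the other points \<open>v\<close> by the line through \<open>p, v\<close> and the distance
  from \<open>p\<close> to \<open>v\<close>. Two points of a class have \<open>p\<close> as their midpoint, so a class of \<open>s\<close> points is
  equilateral and its pairs generate distinct lines, whence \<open>s\<^sup>2 \<le> 4 m\<close>. Therefore
  \<open>(n - 1)\<^sup>2 \<le> (m \<cdot> 2 m\<^sup>2)\<^sup>2 \<cdot> 4 m = 16 m\<^sup>7\<close>.
\<close>

section \<open>Counting tools and basic facts about lines\<close>

lemma card_le_card_mult_fibre_bound:
  assumes "finite A" "finite B" "f ` A \<subseteq> B"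
    and fibre: "\<And>y. y \<in> B \<Longrightarrow> card {x \<in> A. f x = y} \<le> c"
  shows "card A \<le> card B * c"
proof -
  have "A = (\<Union>y\<in>B. {x \<in> A. f x = y})"
    using assms(3) by auto
  then have "card A \<le> (\<Sum>y\<in>B. card {x \<in> A. f x = y})"
    using card_UN_le[OF assms(2), of "\<lambda>y. {x \<in> A. f x = y}"] by simp
  also have "\<dots> \<le> card B * c"
    using sum_bounded_above[of B "\<lambda>y. card {x \<in> A. f x = y}" c] fibre by simp
  finally show ?thesis .
qed

lemma three_elements_if_card_gt_2:
  fixes A :: "'a::linorder set"
  assumes "card A > 2"
  obtains a b c where "a \<in> A" "b \<in> A" "c \<in> A" "a < b" "b < c"
proof -
  have fin: "finite A" and ne: "A \<noteq> {}"
    using assms card_gt_0_iff[of A] by auto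
  have "card {Min A, Max A} \<le> 2"
    by (simp add: card_insert_if)
  then have "\<not> A \<subseteq> {Min A, Max A}"
    using assms card_mono[of "{Min A, Max A}" A] by auto
  then obtain b where b: "b \<in> A" "b \<noteq> Min A" "b \<noteq> Max A"
    by blast
  show thesis
  proof (rule that[of "Min A" b "Max A"])
    show "Min A < b" "b < Max A"
      using Min_le[OF fin b(1)] Max_ge[OF fin b(1)] b(2,3) by order+
  qed (use fin ne b in auto)
qed

lemma metric_line_subset:
  "u \<in> X \<Longrightarrow> v \<in> X \<Longrightarrow> metric_line X d u v \<subseteq> X"
  by (auto simp: metric_line_def between_def)

lemma metric_lineI1: "u \<in> metric_line X d u v"
  and metric_lineI2: "v \<in> metric_line X d u v"
  by (auto simp: metric_line_def)

lemma metric_lines_subset_Pow: "metric_lines X d \<subseteq> Pow X"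
proof
  fix l
  assume "l \<in> metric_lines X d"
  then obtain u v where "u \<in> X" "v \<in> X" "l = metric_line X d u v"
    unfolding metric_lines_def by blast
  then show "l \<in> Pow X"
    using metric_line_subset[of u X v d] by simp
qed

lemma finite_metric_lines: "finite X \<Longrightarrow> finite (metric_lines X d)"
  by (rule finite_subset[OF metric_lines_subset_Pow]) simp

lemma metric_line_in_metric_lines:
  "u \<in> X \<Longrightarrow> v \<in> X \<Longrightarrow> u \<noteq> v \<Longrightarrow> metric_line X d u v \<in> metric_lines X d"
  by (auto simp: metric_lines_def)

section \<open>Chains in a finite metric space\<close>

context Metric_space
begin

lemma mem_metric_line_iff:
  assumes "u \<in> M" "v \<in> M" "u \<noteq> v" "x \<in> M"
  shows "x \<in> metric_line M d u v \<longleftrightarrow>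
    d x u + d u v = d x v \<or> d u x + d x v = d u v \<or> d u v + d v x = d u x"
  using assms by (auto simp: metric_line_def between_def commute)

text \<open>Equality in the triangle inequality would put \<open>x\<close> beyond \<open>u\<close>
  or beyond \<open>v\<close> on their line.\<close>

lemma dist_diff_less_if_not_mem_metric_line:
  assumes "u \<in> M" "v \<in> M" "u \<noteq> v" "x \<in> M" "x \<notin> metric_line M d u v"
  shows "\<bar>d x u - d x v\<bar> < d u v"
proof -
  have "d x u + d u v \<noteq> d x v" "d x v + d u v \<noteq> d x u"
    using assms(5) mem_metric_line_iff[OF assms(1-4)] commute[of u x] commute[of v x]
    by linarith+
  then show ?thesis
    using assms triangle[of x u v] triangle[of x v u] commute[of u v] by (simp add: abs_less_iff)
qed

text \<open>Additivity is asked of all triples, not only of consecutive points, so the chain is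
  isometric to \<open>k + 1\<close> increasing points of the real line.\<close>

definition metric_chain :: "(nat \<Rightarrow> 'a) \<Rightarrow> nat \<Rightarrow> bool" where
  "metric_chain w k \<longleftrightarrow> w ` {..k} \<subseteq> M \<and> inj_on w {..k} \<and>
     (\<forall>h i j. h \<le> i \<longrightarrow> i \<le> j \<longrightarrow> j \<le> k \<longrightarrow> d (w h) (w i) + d (w i) (w j) = d (w h) (w j))"

lemma card_chain_steps_on_line:
  assumes fin: "finite M" and chain: "metric_chain w k" and L: "L \<in> metric_lines M d" "L \<noteq> M"
  shows "card {i \<in> {..<k}. metric_line M d (w i) (w (Suc i)) = L} \<le> card (metric_lines M d) * 2"
proof -
  define K where "K = {i \<in> {..<k}. metric_line M d (w i) (w (Suc i)) = L}"
  have wM: "w i \<in> M" if "i \<le> k" for i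
    using chain that by (auto simp: metric_chain_def)
  have inj: "w i \<noteq> w j" if "i \<le> k" "j \<le> k" "i \<noteq> j" for i j
    using chain that by (auto simp: metric_chain_def dest: inj_onD)
  have add: "d (w h) (w i) + d (w i) (w j) = d (w h) (w j)" if "h \<le> i" "i \<le> j" "j \<le> k" for h i j
    using chain that by (auto simp: metric_chain_def)
  obtain x where x: "x \<in> M" "x \<notin> L"
    using L metric_lines_subset_Pow by blast
  have step: "\<bar>d x (w i) - d x (w (Suc i))\<bar> < d (w i) (w (Suc i))" if "i \<in> K" for i
    using that x wM inj by (intro dist_diff_less_if_not_mem_metric_line) (auto simp: K_def)
  \<comment> \<open>By additivity the line of any single step contains the whole chain, whereas
    \<open>x\<close> is off \<open>L\<close>. Hence \<open>x\<close> and a chain point do span a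
    line.\<close>
  have x_off: "x \<noteq> w j" if "i \<in> K" "j \<le> k" for i j
  proof
    assume "x = w j"
    have "i \<le> k" "Suc i \<le> k" "metric_line M d (w i) (w (Suc i)) = L"
      using that by (auto simp: K_def)
    moreover have "w j \<in> metric_line M d (w i) (w (Suc i))"
    proof (cases "j \<le> i")
      case True
      with add[of j i "Suc i"] calculation wM inj that(2) show ?thesis
        by (subst mem_metric_line_iff) auto
    next
      case False
      with add[of i "Suc i" j] calculation wM inj that(2) show ?thesis
        by (subst mem_metric_line_iff) auto
    qed
    ultimately show False
      using \<open>x = w j\<close> x by simp
  qed
  \<comment> \<open>The first step from \<open>w i\<close> gives the strict inequality; the rest of
    the way to \<open>w j\<close> contributes at most its length.\<close>
  have diff: "\<bar>d x (w i) - d x (w j)\<bar> < d (w i) (w j)" if "i \<in> K" "j \<in> K" "i < j" for i j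
  proof -
    have "Suc i \<le> j" "j \<le> k" "i \<le> k"
      using that by (auto simp: K_def)
    then show ?thesis
      using step[OF that(1)] add[of i "Suc i" j] wM x(1)
        triangle[of x "w (Suc i)" "w j"] triangle[of x "w j" "w (Suc i)"] commute[of "w j" "w (Suc i)"]
      by (auto simp: abs_less_iff)
  qed
  \<comment> \<open>Of the three orders that put \<open>w j\<close> on the line of \<open>x\<close>
    and \<open>w i\<close>, \<open>diff\<close> excludes the two with \<open>x\<close> at an
    end.\<close>
  have mid: "d x (w i) + d x (w j) = d (w i) (w j)"
    if "i \<in> K" "j \<in> K" "i < j" "metric_line M d x (w i) = metric_line M d x (w j)" for i j
  proof -
    have k: "i \<le> k" "j \<le> k"
      using that by (auto simp: K_def)
    have "w j \<in> metric_line M d x (w i)"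
      using that(4) metric_lineI2 by metis
    then show ?thesis
      using mem_metric_line_iff[of x "w i" "w j"] x(1) x_off[OF that(1) k(1)] wM k diff[OF that(1-3)]
      by (auto simp: commute)
  qed
  have "card K \<le> card (metric_lines M d) * 2"
  proof (rule card_le_card_mult_fibre_bound)
    show "finite K"
      by (simp add: K_def)
    show "finite (metric_lines M d)"
      by (rule finite_metric_lines[OF fin])
    show "(\<lambda>i. metric_line M d x (w i)) ` K \<subseteq> metric_lines M d"
    proof (rule image_subsetI)
      show "metric_line M d x (w i) \<in> metric_lines M d" if "i \<in> K" for i
        using x(1) wM[of i] x_off[OF that, of i] that
        by (intro metric_line_in_metric_lines) (auto simp: K_def)
    qed
    fix l
    show "card {i \<in> K. metric_line M d x (w i) = l} \<le> 2"
    proof (rule ccontr)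
      assume "\<not> ?thesis"
      then have "card {i \<in> K. metric_line M d x (w i) = l} > 2"
        by simp
      then obtain h i j where *: "h \<in> K" "i \<in> K" "j \<in> K" "h < i" "i < j"
        "metric_line M d x (w h) = l" "metric_line M d x (w i) = l" "metric_line M d x (w j) = l"
        by (rule three_elements_if_card_gt_2) blast
      then have k: "i \<le> k" "j \<le> k"
        by (auto simp: K_def)
      \<comment> \<open>Adding \<open>mid\<close> for \<open>h, i\<close> and for
        \<open>i, j\<close> and subtracting it for \<open>h, j\<close> leaves
        \<open>2 * d x (w i) = 0\<close>.\<close>
      have "d x (w i) = 0"
        using * mid[of h i] mid[of i j] mid[of h j] add[of h i j] k by simp
      then show False
        using x(1) wM k x_off[OF *(1)] by simp
    qed
  qed
  then show ?thesis
    by (simp add: K_def)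
qed

lemma metric_chain_length_le:
  assumes fin: "finite M" and no_univ: "M \<notin> metric_lines M d" and chain: "metric_chain w k"
  shows "k \<le> 2 * (card (metric_lines M d))\<^sup>2"
proof -
  have "card {..<k} \<le> card (metric_lines M d) * (card (metric_lines M d) * 2)"
  proof (rule card_le_card_mult_fibre_bound)
    show "finite (metric_lines M d)"
      by (rule finite_metric_lines[OF fin])
    show "(\<lambda>i. metric_line M d (w i) (w (Suc i))) ` {..<k} \<subseteq> metric_lines M d"
    proof (rule image_subsetI)
      fix i
      assume "i \<in> {..<k}"
      then have "i \<in> {..k}" "Suc i \<in> {..k}"
        by auto
      then have "w i \<in> M" "w (Suc i) \<in> M" "w i \<noteq> w (Suc i)"
        using chain by (auto simp: metric_chain_def dest: inj_onD)
      then show "metric_line M d (w i) (w (Suc i)) \<in> metric_lines M d"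
        by (rule metric_line_in_metric_lines)
    qed
    show "card {i \<in> {..<k}. metric_line M d (w i) (w (Suc i)) = l} \<le> card (metric_lines M d) * 2"
      if "l \<in> metric_lines M d" for l
      using that no_univ by (intro card_chain_steps_on_line fin chain) auto
  qed simp
  then show ?thesis
    by (simp add: power2_eq_square)
qed

section \<open>Equilateral sets and classes of points around a fixed point\<close>

text \<open>Since \<open>r + r\<close> differs from \<open>r\<close>, the line of a pair contains no
  third point of \<open>S\<close>. So every pair is the trace on \<open>S\<close> of some
  line.\<close>

lemma card_equilateral_choose_2_le:
  assumes fin: "finite M" and "S \<subseteq> M"
    and eq: "\<And>u v. u \<in> S \<Longrightarrow> v \<in> S \<Longrightarrow> u \<noteq> v \<Longrightarrow> d u v = r"
  shows "card S choose 2 \<le> card (metric_lines M d)"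
proof -
  have "{T. T \<subseteq> S \<and> card T = 2} \<subseteq> (\<lambda>l. l \<inter> S) ` metric_lines M d"
  proof
    fix T
    assume "T \<in> {T. T \<subseteq> S \<and> card T = 2}"
    then obtain u v where T: "T = {u, v}" "u \<noteq> v" "u \<in> S" "v \<in> S"
      by (auto simp: card_2_iff)
    then have M: "u \<in> M" "v \<in> M"
      using \<open>S \<subseteq> M\<close> by auto
    then have "r > 0"
      using eq[of u v] T mdist_pos_eq[of u v] by simp
    have "x \<notin> metric_line M d u v" if x: "x \<in> S" "x \<noteq> u" "x \<noteq> v" for x
    proof -
      have "x \<in> M" "d x u = r" "d u v = r" "d x v = r" "d u x = r" "d v x = r"
        using x T \<open>S \<subseteq> M\<close> eq by auto
      with \<open>r > 0\<close> show ?thesis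
        by (simp add: mem_metric_line_iff[OF M T(2)])
    qed
    then have "metric_line M d u v \<inter> S = T"
      using T(1,3,4) metric_lineI1[of u M d v] metric_lineI2[of v M d u] by blast
    moreover have "metric_line M d u v \<in> metric_lines M d"
      by (rule metric_line_in_metric_lines[OF M T(2)])
    ultimately show "T \<in> (\<lambda>l. l \<inter> S) ` metric_lines M d"
      by blast
  qed
  then have "card {T. T \<subseteq> S \<and> card T = 2} \<le> card (metric_lines M d)"
    by (rule surj_card_le[OF finite_metric_lines[OF fin]])
  then show ?thesis
    using n_subsets[of S 2] finite_subset[OF \<open>S \<subseteq> M\<close> fin] by simp
qed

text \<open>The points are collinear, and with \<open>d p u = d p v\<close> any order having
  \<open>p\<close> at an end would force \<open>d u v = 0\<close>.\<close>

lemma dist_eq_if_metric_line_eq: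
  assumes M: "p \<in> M" "u \<in> M" "v \<in> M" and "p \<noteq> u" "u \<noteq> v" and "d p u = d p v"
    and "metric_line M d p u = metric_line M d p v"
  shows "d u v = 2 * d p u"
proof -
  have "v \<in> metric_line M d p u"
    using assms(7) metric_lineI2 by metis
  then have "d v p + d p u = d v u \<or> d p v + d v u = d p u \<or> d p u + d u v = d p v"
    using mem_metric_line_iff[OF M(1,2) \<open>p \<noteq> u\<close> M(3)] by simp
  moreover have "d u v > 0"
    using M \<open>u \<noteq> v\<close> by simp
  ultimately show ?thesis
    using \<open>d p u = d p v\<close> commute[of u v] commute[of p v] by linarith
qed

text \<open>The classes are the fibres of \<open>cls\<close>. The bound is squared because the class
  sizes are bounded through their squares, which keeps everything in the natural numbers.\<close>

lemma card_le_if_finite_distances: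
  assumes fin: "finite M" and "p \<in> M" and fR: "finite R"
    and R: "\<And>v. v \<in> M \<Longrightarrow> v \<noteq> p \<Longrightarrow> d p v \<in> R"
  shows "(card M - 1)\<^sup>2 \<le> 4 * (card R)\<^sup>2 * card (metric_lines M d) ^ 3"
proof (cases "M = {p}")
  case False
  define m where "m = card (metric_lines M d)"
  define cls where "cls v = (metric_line M d p v, d p v)" for v
  define F where "F y = card {v \<in> M - {p}. cls v = y}" for y
  let ?B = "metric_lines M d \<times> R"
  let ?s = "Max (F ` ?B)"
  have finB: "finite ?B"
    using fR finite_metric_lines[OF fin] by simp
  have sub: "cls ` (M - {p}) \<subseteq> ?B"
    using R metric_line_in_metric_lines[OF \<open>p \<in> M\<close>] by (auto simp: cls_def)
  have "?B \<noteq> {}"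
    using sub False \<open>p \<in> M\<close> by auto
  then have m: "m \<ge> 1"
    using finite_metric_lines[OF fin, of d] by (auto simp: m_def Suc_le_eq card_gt_0_iff)
  have F: "(F y)\<^sup>2 \<le> 4 * m" for y
  proof -
    define S where "S = {v \<in> M - {p}. cls v = y}"
    have "card S choose 2 \<le> m"
      unfolding m_def
    proof (rule card_equilateral_choose_2_le[OF fin])
      show "S \<subseteq> M"
        by (auto simp: S_def)
      show "d u v = 2 * snd y" if "u \<in> S" "v \<in> S" "u \<noteq> v" for u v
        using that dist_eq_if_metric_line_eq[of p u v] \<open>p \<in> M\<close> by (auto simp: S_def cls_def)
    qed
    \<comment> \<open>The division by 2 in the binomial coefficient rounds down, which costs the
      \<open>+ 1\<close>; parity removes it below.\<close>
    then have *: "card S * (card S - 1) \<le> 2 * m + 1"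
      unfolding choose_two by linarith
    have "(card S)\<^sup>2 \<le> 4 * m"
    proof (cases "card S \<le> 1")
      case True
      then have "(card S)\<^sup>2 \<le> 1\<^sup>2"
        by (rule power_mono) simp
      then show ?thesis
        using m by simp
    next
      case False
      have "even (card S * (card S - 1))"
        by (cases "even (card S)") auto
      then have "card S * (card S - 1) \<noteq> 2 * m + 1"
        by (metis even_plus_one_iff even_mult_iff even_numeral)
      then have "2 * (card S * (card S - 1)) \<le> 4 * m"
        using * by linarith
      \<comment> \<open>Here \<open>s \<le> 2 * (s - 1)\<close>, as the class size \<open>s\<close>
        is at least 2.\<close>
      moreover have "card S * card S \<le> card S * (2 * (card S - 1))"
        using False by (intro mult_le_mono2) linarith
      ultimately show ?thesis
        unfolding power2_eq_square mult.left_commute[of _ 2] by (rule order_trans[rotated])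
    qed
    then show ?thesis
      by (simp add: F_def S_def)
  qed
  have "card (M - {p}) \<le> card ?B * ?s"
  proof (rule card_le_card_mult_fibre_bound[OF _ finB sub])
    show "card {v \<in> M - {p}. cls v = y} \<le> ?s" if "y \<in> ?B" for y
      using Max_ge[of "F ` ?B" "F y"] that finB by (simp add: F_def)
  qed (use fin in simp)
  then have "(card M - 1)\<^sup>2 \<le> (card ?B)\<^sup>2 * ?s\<^sup>2"
    using fin \<open>p \<in> M\<close> by (simp add: power_mult_distrib[symmetric] power_mono)
  also have "?s\<^sup>2 \<le> 4 * m"
  proof -
    have "?s \<in> F ` ?B"
      using finB \<open>?B \<noteq> {}\<close> by (intro Max_in) simp_all
    then show ?thesis
      using F by (metis imageE)
  qed
  finally show ?thesis
    by (simp add: card_cartesian_product m_def[symmetric] power_mult_distrib power2_eq_square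
        power3_eq_cube algebra_simps)
qed (use assms in simp)

end

section \<open>Shortest paths as chains\<close>

context graph
begin

text \<open>Turns a list of arcs into the sequence of visited vertices; for shortest paths, exact
  distances follow from the bound by 1.\<close>

lemma awalk_sequence:
  assumes "awalk u p v"
  obtains w where "w 0 = u" "w (length p) = v" "\<And>i. i \<le> length p \<Longrightarrow> w i \<in> verts G"
    "\<And>i. i < length p \<Longrightarrow> graph_dist G (w i) (w (Suc i)) \<le> 1"
  using assms
proof (induct p arbitrary: u thesis)
  case Nil
  then show ?case
    by (auto simp: awalk_Nil_iff)
next
  case (Cons e p)
  then have e: "e \<in> arcs G" "tail G e = u" and p: "awalk (head G e) p v"
    by (auto simp: awalk_Cons_iff)
  obtain w where w: "w 0 = head G e" "w (length p) = v" "\<And>i. i \<le> length p \<Longrightarrow> w i \<in> verts G"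
    "\<And>i. i < length p \<Longrightarrow> graph_dist G (w i) (w (Suc i)) \<le> 1"
    using Cons.hyps[OF _ p] by blast
  have "awalk u [e] (head G e)"
    using e arc_implies_awalk by metis
  then have "graph_dist G u (head G e) \<le> 1"
    using graph_dist_le_awalk[of u "[e]" "head G e"] by simp
  have "u \<in> verts G"
    using e by auto
  show ?case
  proof (intro Cons.prems(1)[of "case_nat u w"])
    show "case_nat u w i \<in> verts G" if "i \<le> length (e # p)" for i
      using that w(3) \<open>u \<in> verts G\<close> by (cases i) auto
    show "graph_dist G (case_nat u w i) (case_nat u w (Suc i)) \<le> 1" if "i < length (e # p)" for i
      using that w(1,4) \<open>graph_dist G u (head G e) \<le> 1\<close> by (cases i) auto
  qed (use w(2) in auto)
qed

lemma geodesic_chain: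
  assumes con: "Digraph_Component.connected G" and "u \<in> verts G" "v \<in> verts G"
  obtains w k where "graph_dist G u v = real k" "Metric_space.metric_chain (verts G) (graph_dist G) w k"
proof -
  interpret Metric_space "verts G" "graph_dist G"
    by (rule Metric_space_graph_dist[OF con])
  obtain p where p: "apath u p v" "graph_dist G u v = real (length p)"
    using graph_dist_attained[OF assms] by blast
  define k where "k = length p"
  obtain w where w: "w 0 = u" "w k = v" "\<And>i. i \<le> k \<Longrightarrow> w i \<in> verts G"
    "\<And>i. i < k \<Longrightarrow> graph_dist G (w i) (w (Suc i)) \<le> 1"
    using awalk_sequence[OF awalkI_apath[OF p(1)]] unfolding k_def by blast
  have le: "graph_dist G (w i) (w j) \<le> real (j - i)" if "i \<le> j" "j \<le> k" for i j
    using that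
  proof (induct j rule: dec_induct)
    case base
    then show ?case
      using w(3) by simp
  next
    case (step j)
    then show ?case
      using w(3)[of i] w(3)[of j] w(3)[of "Suc j"] w(4)[of j]
        triangle[of "w i" "w j" "w (Suc j)"]
      by (simp add: Suc_diff_le)
  qed
  \<comment> \<open>A shortest path has no slack: \<open>k\<close> is at most
    \<open>i + graph_dist G (w i) (w j) + (k - j)\<close>.\<close>
  have eq: "graph_dist G (w i) (w j) = real (j - i)" if "i \<le> j" "j \<le> k" for i j
  proof (rule antisym)
    have "real k \<le> graph_dist G u (w i) + graph_dist G (w i) v"
      using triangle[of u "w i" v] w(3)[of i] p(2) assms that by (simp add: k_def)
    also have "graph_dist G (w i) v \<le> graph_dist G (w i) (w j) + graph_dist G (w j) v"
      using triangle[of "w i" "w j" v] w(3) assms that by simp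
    finally show "real (j - i) \<le> graph_dist G (w i) (w j)"
      using le[of 0 i] le[of j k] that w(1,2) by (simp add: of_nat_diff)
  qed (rule le[OF that])
  have "inj_on w {..k}"
  proof (rule linorder_inj_onI)
    show "w i \<noteq> w j" if "i < j" "i \<in> {..k}" "j \<in> {..k}" for i j
      using eq[of i j] that w(3) by auto
  qed auto
  then have "metric_chain w k"
    using w(3) eq by (auto simp: metric_chain_def)
  then show thesis
    using that p(2) by (simp add: k_def)
qed

lemma card_verts_le_metric_lines:
  assumes con: "Digraph_Component.connected G"
    and no_univ: "verts G \<notin> metric_lines (verts G) (graph_dist G)"
  shows "(card (verts G) - 1)\<^sup>2 \<le> 16 * card (metric_lines (verts G) (graph_dist G)) ^ 7"
proof (cases "verts G = {}")
  case False
  then obtain p where p: "p \<in> verts G"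
    by blast
  interpret Metric_space "verts G" "graph_dist G"
    by (rule Metric_space_graph_dist[OF con])
  define m where "m = card (metric_lines (verts G) (graph_dist G))"
  \<comment> \<open>Each distance from \<open>p\<close> to another vertex is the length of a chain,
    hence a positive integer subject to the chain bound.\<close>
  let ?R = "real ` {1..2 * m\<^sup>2}"
  have "graph_dist G p v \<in> ?R" if v: "v \<in> verts G" "v \<noteq> p" for v
  proof -
    obtain w k where k: "graph_dist G p v = real k" "metric_chain w k"
      by (rule geodesic_chain[OF con p v(1)])
    have "k \<noteq> 0"
      using k(1) zero[OF p v(1)] v(2) by auto
    moreover have "k \<le> 2 * m\<^sup>2"
      using metric_chain_length_le[OF finite_verts no_univ k(2)] by (simp add: m_def)
    ultimately show ?thesis
      using k(1) by simp
  qed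
  then have "(card (verts G) - 1)\<^sup>2 \<le> 4 * (card ?R)\<^sup>2 * m ^ 3"
    using card_le_if_finite_distances[OF finite_verts p, of ?R] unfolding m_def by blast
  also have "card ?R = 2 * m\<^sup>2"
    by (simp add: card_image)
  also have "4 * (2 * m\<^sup>2)\<^sup>2 * m ^ 3 = 16 * m ^ 7"
    by (simp add: power_mult_distrib mult.assoc flip: power_mult power_add)
  finally show ?thesis
    by (simp add: m_def)
qed simp

end

text \<open>A single vertex spans no line, so the bound would fail for \<open>n = 1\<close>.\<close>

theorem corollary1:
  fixes G :: "('a, 'b) pre_digraph" and n :: nat
  assumes "Digraph.graph G"
    and "Digraph_Component.connected G"
    and "card (verts G) = n"
    and "n \<ge> 2"
    and "verts G \<notin> metric_lines (verts G) (graph_dist G)"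
  shows "real (card (metric_lines (verts G) (graph_dist G))) \<ge> 2 powr (-8/7) * real n powr (2/7)"
proof -
  define m where "m = card (metric_lines (verts G) (graph_dist G))"
  \<comment> \<open>Passing from \<open>n - 1\<close> to \<open>n\<close> costs a factor 4, whence
    \<open>64 = 4 * 16\<close>.\<close>
  have "n\<^sup>2 \<le> (2 * (n - 1))\<^sup>2"
    using \<open>n \<ge> 2\<close> by (intro power_mono) auto
  also have "\<dots> \<le> 64 * m ^ 7"
    using graph.card_verts_le_metric_lines[OF assms(1,2,5)] assms(3)
    by (simp add: m_def power_mult_distrib)
  finally have n: "n\<^sup>2 \<le> 64 * m ^ 7" .
  then have m: "m > 0"
    using \<open>n \<ge> 2\<close> by (cases "m = 0") auto
  have "real n powr 2 = real (n\<^sup>2)"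
    using \<open>n \<ge> 2\<close> by (simp add: powr_numeral)
  \<comment> \<open>Weakening 64 to \<open>256 = 2 ^ 8\<close> gives the stated constant after the
    seventh root.\<close>
  also have "\<dots> \<le> real (256 * m ^ 7)"
    using n by (intro of_nat_mono) linarith
  also have "\<dots> = 2 powr 8 * real m powr 7"
    using m by (simp add: powr_numeral)
  finally have "(real n powr 2) powr (1/7) \<le> (2 powr 8 * real m powr 7) powr (1/7)"
    by (intro powr_mono2) auto
  also have "\<dots> = 2 powr (8/7) * real m"
    using m by (subst powr_mult) (simp_all only: powr_powr, simp_all)
  finally have "real n powr (2/7) \<le> 2 powr (8/7) * real m"
    by (simp only: powr_powr) simp
  then have "2 powr (-8/7) * real n powr (2/7) \<le> 2 powr (-8/7) * (2 powr (8/7) * real m)"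
    by (intro mult_left_mono) auto
  also have "\<dots> = real m"
    by (simp only: mult.assoc[symmetric] powr_add[symmetric]) simp
  finally show ?thesis
    by (simp add: m_def)
qed

end
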